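(* For all integers $n\geq 5$ and $p\geq 0$, $$\left(\sum_{i = 0}^{p} \binom{p}{i} B_{n+i-1}\right)\left(\sum_{j=1}^{n-1}(-1)^{j+1}\sum_{i = 0}^{p} \binom{p}{i} B_{n+i-j+1}\right)>\left(\sum_{i = 0}^{p} \binom{p}{i} B_{n+i}\right)\left(\sum_{j=1}^{n-1}(-1)^{j+1}\sum_{i = 0}^{p} \binom{p}{i} B_{n+i-j}\right).$$
   Context: For $n\ge 0$, $B_n$ denotes the $n$-th Bell number, i.e. the number of partitions of a set with $n$ elements ($B_0=B_1=1$, $B_2=2$, $B_3=5$, $B_4=15$, ...). *)

theory Defs
  imports Complex_Main "HOL-Library.Disjoint_Sets"
begin

definition Bell :: "nat \<Rightarrow> nat" where
  "Bell n = card {P. partition_on {..<n} P}"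

end

theory Submission
  imports Defs
begin

text \<open>
  Dobinski's formula turns the sums of Bell numbers into moments of the weights
  \<open>v x = (x + 1) ^ p / (x + 1)!\<close>: up to the factor \<open>exp 1\<close> the four expressions in the theorem are
  \<open>\<Sum>v x * (x + 1) * x ^ (n - 1)\<close>, \<open>\<Sum>v x * x * g x\<close>, \<open>\<Sum>v x * (x + 1) * x ^ n\<close> and \<open>\<Sum>v x * g x\<close>
  with \<open>g x = x ^ n + (-1) ^ n * x\<close>. The difference of the two products is then a sum of
  \<open>v x * v y * K x y\<close> over pairs \<open>x < y\<close>. The kernel \<open>K\<close> is nonnegative, except
  that \<open>K 1 y\<close> is negative for even \<open>n\<close>; those terms are outweighed by the pairs \<open>(2, y)\<close> when
  \<open>y \<ge> 4\<close> and by the pair \<open>(2, 3)\<close> otherwise.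
\<close>

section \<open>Dobinski's formula\<close>

text \<open>A partition of \<open>insert a A\<close> is determined by the block of \<open>a\<close>,
  recorded as \<open>B\<close> without \<open>a\<close>, and by what it leaves on
  \<open>A - B\<close>. This is the Bell recurrence in bijective form.\<close>

lemma bij_betw_partition_on_insert:
  assumes "a \<notin> A"
  shows "bij_betw (\<lambda>(B, P). insert (insert a B) P)
           (SIGMA B:Pow A. {P. partition_on (A - B) P}) {P. partition_on (insert a A) P}"
proof (rule bij_betw_imageI)
  show "inj_on (\<lambda>(B, P). insert (insert a B) P) (SIGMA B:Pow A. {P. partition_on (A - B) P})"
  proof (rule inj_onI, clarsimp)
    fix B P B' P'
    assume B: "B \<subseteq> A" "B' \<subseteq> A" and P: "partition_on (A - B) P" "partition_on (A - B') P'"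
      and eq: "insert (insert a B) P = insert (insert a B') P'"
    have notin: "a \<notin> q" if "q \<in> P \<or> q \<in> P'" for q
      using that P[THEN partition_onD1] assms by blast
    have "insert a B \<in> insert (insert a B') P'"
      using eq by blast
    then have ins: "insert a B = insert a B'"
      using notin by blast
    then have "B = B'"
      using B assms ins by (metis insert_ident subsetD)
    moreover have "insert a B \<notin> P" "insert a B \<notin> P'"
      using notin by blast+
    ultimately show "B = B' \<and> P = P'"
      using eq by (simp add: insert_ident)
  qed
  have partition_insert: "partition_on (insert a A) (insert (insert a B) P)"
    if "B \<subseteq> A" "partition_on (A - B) P" for B P
  proof -
    have "insert a A - insert a B = A - B"
      using assms by blast
    moreover have "disjnt (insert a B) (\<Union>P)"
      using partition_onD1[OF that(2)] assms by (auto simp: disjnt_iff)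
    ultimately show ?thesis
      using that by (auto simp: partition_on_insert)
  qed
  have "Q \<in> (\<lambda>(B, P). insert (insert a B) P) ` (SIGMA B:Pow A. {P. partition_on (A - B) P})"
    if Q: "partition_on (insert a A) Q" for Q
  proof -
    obtain q where q: "q \<in> Q" "a \<in> q"
      using partition_onD1[OF Q] by blast
    have disj: "disjnt q (\<Union>(Q - {q}))"
      using partition_onD2[OF Q] q by (auto simp: disjnt_iff disjoint_def)
    have Q': "insert q (Q - {q}) = Q"
      using q by blast
    have qa: "insert a (q - {a}) = q"
      using q by blast
    have "partition_on (insert a A - q) (Q - {q})" "q \<subseteq> insert a A"
      using Q partition_on_insert[OF disj, of "insert a A"] Q' by auto
    moreover have "insert a A - q = A - (q - {a})"
      using q assms by blast
    ultimately have "(q - {a}, Q - {q}) \<in> (SIGMA B:Pow A. {P. partition_on (A - B) P})"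
      by auto
    then show ?thesis
      by (rule rev_image_eqI) (simp add: insert_absorb q)
  qed
  then show "(\<lambda>(B, P). insert (insert a B) P) ` (SIGMA B:Pow A. {P. partition_on (A - B) P})
      = {P. partition_on (insert a A) P}"
    using partition_insert by auto
qed

lemma finite_partitions: "finite A \<Longrightarrow> finite {P. partition_on A P}"
  by (rule finite_subset[of _ "Pow (Pow A)"]) (auto simp: partition_on_def)

text \<open>Dobinski's formula: both sides satisfy the Bell recurrence. Inducting on the set rather
  than on its size turns the recurrence into a plain sum over \<open>Pow A'\<close>.\<close>

lemma card_partitions_sums:
  assumes "finite A"
  shows "(\<lambda>k. real k ^ card A / fact k) sums (exp 1 * real (card {P. partition_on A P}))"
  using assms
proof (induction A rule: finite_psubset_induct)
  case (psubset A)
  show ?case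
  proof (cases "A = {}")
    case True
    then show ?thesis
      using exp_converges[of "1::real"] by (simp add: partition_on_empty scaleR_conv_of_real field_simps)
  next
    case False
    then obtain a A' where A: "A = insert a A'" "a \<notin> A'"
      by (meson ex_in_conv mk_disjoint_insert)
    have fin: "finite A'"
      using psubset.hyps A by simp
    have "card {P. partition_on A P} = card (SIGMA B:Pow A'. {P. partition_on (A' - B) P})"
      using bij_betw_same_card[OF bij_betw_partition_on_insert[OF A(2)]] A by simp
    also have "\<dots> = (\<Sum>B\<in>Pow A'. card {P. partition_on (A' - B) P})"
      using fin by (simp add: card_SigmaI finite_partitions)
    finally have card: "card {P. partition_on A P} = \<dots>" .
    have "(\<lambda>k. real k ^ card (A' - B) / fact k) sums
        (exp 1 * real (card {P. partition_on (A' - B) P}))" for B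
      by (rule psubset.IH) (use A in auto)
    then have "(\<lambda>k. \<Sum>B\<in>Pow A'. real k ^ card (A' - B) / fact k) sums
        (\<Sum>B\<in>Pow A'. exp 1 * real (card {P. partition_on (A' - B) P}))"
      by (intro sums_sum)
    \<comment> \<open>The sum over subsets expands \<open>(1 + k) ^ card A'\<close>; extending the
      fraction by \<open>k + 1\<close> gives the Dobinski term of \<open>A\<close> at index
      \<open>Suc k\<close>.\<close>
    moreover have "(\<Sum>B\<in>Pow A'. real k ^ card (A' - B) / fact k)
        = real (Suc k) ^ card A / fact (Suc k)" for k
    proof -
      have "(1 + real k) ^ card A' = (\<Sum>B\<in>Pow A'. real k ^ card (A' - B))"
        using prod_add[OF fin, of "\<lambda>_. 1" "\<lambda>_. real k"] by simp
      then show ?thesis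
        using A fin by (simp flip: sum_divide_distrib)
    qed
    ultimately have "(\<lambda>k. real (Suc k) ^ card A / fact (Suc k)) sums
        (exp 1 * real (card {P. partition_on A P}))"
      by (simp add: card sum_distrib_left)
    \<comment> \<open>The term at index 0 that the shift leaves out is zero because
      \<open>card A > 0\<close>.\<close>
    then show ?thesis
      by (subst (asm) sums_Suc_iff) (use False psubset.hyps in \<open>simp add: zero_power card_gt_0_iff\<close>)
  qed
qed

lemma Bell_sums: "(\<lambda>k. real k ^ m / fact k) sums (exp 1 * real (Bell m))"
  using card_partitions_sums[of "{..<m}"] by (simp add: Bell_def)

text \<open>The binomial theorem leaves \<open>(k + 1) ^ p / fact k\<close> in the Dobinski terms.
  Writing this as \<open>Bell_weight p k * (k + 1)\<close> supplies the factor that makes the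
  alternating sums telescope.\<close>

definition Bell_weight :: "nat \<Rightarrow> nat \<Rightarrow> real" where
  "Bell_weight p k = real (Suc k) ^ p / fact (Suc k)"

lemma Bell_weight_pos: "Bell_weight p k > 0"
  by (simp add: Bell_weight_def)

lemma binomial_Bell_sums:
  "(\<lambda>k. Bell_weight p k * ((real k + 1) * real k ^ m)) sums
     (exp 1 * (\<Sum>i=0..p. real (p choose i) * real (Bell (m + i))))"
proof -
  have "(\<lambda>k. \<Sum>i=0..p. real (p choose i) * (real k ^ (m + i) / fact k)) sums
     (\<Sum>i=0..p. real (p choose i) * (exp 1 * real (Bell (m + i))))"
    by (intro sums_sum sums_mult Bell_sums)
  moreover have "(\<Sum>i=0..p. real (p choose i) * (real k ^ (m + i) / fact k)) =
      Bell_weight p k * ((real k + 1) * real k ^ m)" for k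
  proof -
    have "(real k + 1) ^ p = (\<Sum>i=0..p. real (p choose i) * real k ^ i)"
      by (subst binomial_ring) (simp add: atMost_atLeast0)
    then have "(\<Sum>i=0..p. real (p choose i) * (real k ^ (m + i) / fact k)) =
        real k ^ m * (real k + 1) ^ p / fact k"
      by (simp add: sum_distrib_left sum_divide_distrib power_add mult_ac)
    also have "\<dots> = Bell_weight p k * ((real k + 1) * real k ^ m)"
      by (simp add: Bell_weight_def divide_simps) (simp add: algebra_simps)
    finally show ?thesis .
  qed
  ultimately show ?thesis
    by (simp add: sum_distrib_left mult_ac)
qed

text \<open>Telescoping: \<open>(x + 1) * x ^ (n - j)\<close> is
  \<open>x ^ (n - j + 1) + x ^ (n - j)\<close>, and only the two end terms survive.\<close>

lemma alternating_geometric_sum: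
  fixes x :: real
  assumes "n \<ge> 1"
  shows "(\<Sum>j=1..n-1. (-1) ^ (j + 1) * ((x + 1) * x ^ (n - j))) = x ^ n + (-1) ^ n * x"
proof -
  have "(\<Sum>j=1..m. (-1) ^ (j + 1) * ((x + 1) * x ^ (Suc m - j))) = x ^ Suc m + (-1) ^ Suc m * x" for m
  proof (induction m)
    case (Suc m)
    have "(\<Sum>j=1..m. (-1) ^ (j + 1) * ((x + 1) * x ^ (Suc (Suc m) - j)))
        = x * (\<Sum>j=1..m. (-1) ^ (j + 1) * ((x + 1) * x ^ (Suc m - j)))"
      by (auto simp: sum_distrib_left Suc_diff_le intro!: sum.cong)
    then show ?case
      unfolding Suc.IH by (simp add: algebra_simps)
  qed auto
  from this[of "n - 1"] show ?thesis
    using assms by simp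
qed

text \<open>The shift \<open>r\<close> serves both alternating sums of the theorem:
  \<open>r = 0\<close> for the index \<open>n + i - j\<close> and \<open>r = 1\<close> for
  \<open>n + i - j + 1\<close>.\<close>

lemma alternating_Bell_sums:
  assumes "n \<ge> 1"
  shows "(\<lambda>k. Bell_weight p k * (real k ^ r * (real k ^ n + (-1) ^ n * real k))) sums
     (exp 1 * (\<Sum>j=1..n-1. (-1) ^ (j + 1) *
        (\<Sum>i=0..p. real (p choose i) * real (Bell (n + i - j + r)))))"
proof -
  have "(\<lambda>k. \<Sum>j=1..n-1. (-1) ^ (j + 1) * (Bell_weight p k * ((real k + 1) * real k ^ (n - j + r)))) sums
     (\<Sum>j=1..n-1. (-1) ^ (j + 1) * (exp 1 * (\<Sum>i=0..p. real (p choose i) * real (Bell (n - j + r + i)))))"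
    by (intro sums_sum sums_mult binomial_Bell_sums)
  moreover have "(\<Sum>j=1..n-1. (-1) ^ (j + 1) * (Bell_weight p k * ((real k + 1) * real k ^ (n - j + r))))
      = Bell_weight p k * (real k ^ r * (real k ^ n + (-1) ^ n * real k))" for k
  proof -
    have "(\<Sum>j=1..n-1. (-1) ^ (j + 1) * (Bell_weight p k * ((real k + 1) * real k ^ (n - j + r))))
        = Bell_weight p k * real k ^ r * (\<Sum>j=1..n-1. (-1) ^ (j + 1) * ((real k + 1) * real k ^ (n - j)))"
      unfolding sum_distrib_left by (intro sum.cong refl) (simp add: power_add)
    then show ?thesis
      unfolding alternating_geometric_sum[OF assms] by (simp add: mult.assoc)
  qed
  \<comment> \<open>The natural subtraction does not truncate, since
    \<open>j \<le> n - 1\<close>.\<close>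
  moreover have "(\<Sum>j=1..n-1. (-1) ^ (j + 1) * (exp 1 * (\<Sum>i=0..p. real (p choose i) * real (Bell (n - j + r + i)))))
      = exp 1 * (\<Sum>j=1..n-1. (-1) ^ (j + 1) * (\<Sum>i=0..p. real (p choose i) * real (Bell (n + i - j + r))))"
    unfolding sum_distrib_left by (intro sum.cong refl) (auto simp: add_ac)
  ultimately show ?thesis
    by simp
qed

section \<open>Positivity of the kernel\<close>

text \<open>The parameters stand for \<open>m = n - 2\<close> and \<open>e = (-1) ^ n\<close>. In
  this factored form only the last bracket can be negative when
  \<open>0 \<le> x \<le> y\<close>.\<close>

definition kernel :: "nat \<Rightarrow> real \<Rightarrow> real \<Rightarrow> real \<Rightarrow> real" where
  "kernel m e x y = (y - x) * x * y * ((x * y) ^ m * (y - x) - e * (y ^ m * (y + 1) - x ^ m * (x + 1)))"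

text \<open>The left side collects the two orders of a pair in the double sum of
  \<open>(y - x) * a x * g y\<close>, where \<open>a x = (x + 1) * x ^ (m + 1)\<close> and
  \<open>g y = y ^ (m + 2) + e * y\<close>.\<close>

lemma kernel_eq:
  "(y - x) * (((x + 1) * x ^ (m + 1)) * (y ^ (m + 2) + e * y) - ((y + 1) * y ^ (m + 1)) * (x ^ (m + 2) + e * x))
    = kernel m e x y"
  unfolding kernel_def by (simp add: power_mult_distrib algebra_simps power2_eq_square)

text \<open>With \<open>e = -1\<close> both summands of the bracket are nonnegative, because
  \<open>t ^ m * (t + 1)\<close> increases for \<open>t \<ge> 0\<close>.\<close>

lemma kernel_minus_nonneg:
  assumes "0 \<le> x" "x \<le> y"
  shows "kernel m (-1) x y \<ge> 0"
proof -
  have "x ^ m * (x + 1) \<le> y ^ m * (y + 1)"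
    using assms by (intro mult_mono power_mono) auto
  moreover have "(x * y) ^ m * (y - x) \<ge> 0"
    using assms by simp
  ultimately have "(x * y) ^ m * (y - x) - -1 * (y ^ m * (y + 1) - x ^ m * (x + 1)) \<ge> 0"
    by (simp add: algebra_simps)
  then show ?thesis
    using assms unfolding kernel_def by (intro mult_nonneg_nonneg) simp_all
qed

text \<open>After division by \<open>y ^ m\<close> it suffices that
  \<open>y + 1 \<le> x ^ m * (y - x)\<close>. This follows from \<open>x ^ m \<ge> 4 * x\<close> and
  \<open>y - x \<ge> 1\<close>.\<close>

lemma kernel_plus_nonneg:
  assumes "2 \<le> x" "x + 1 \<le> y" "m \<ge> 3"
  shows "kernel m 1 x y \<ge> 0"
proof -
  define d where "d = y - x"
  have y: "y = x + d" and d: "d \<ge> 1"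
    using assms by (auto simp: d_def)
  have "4 * x \<le> x ^ 3"
    using mult_mono[of 2 x 2 x] assms(1) by (simp add: power3_eq_cube)
  also have "\<dots> \<le> x ^ m"
    using assms by (intro power_increasing) auto
  finally have xm: "4 * x \<le> x ^ m" .
  have "y + 1 \<le> 4 * x * d"
  proof -
    have "x * 1 \<le> x * d" "1 * d \<le> x * d"
      using assms(1) d by (auto intro!: mult_mono)
    then show ?thesis
      using y d by linarith
  qed
  also have "\<dots> \<le> x ^ m * d"
    using xm d by (intro mult_right_mono) auto
  finally have "y ^ m * (y + 1) \<le> y ^ m * (x ^ m * d)"
    using assms by (intro mult_left_mono) auto
  moreover have "x ^ m * (x + 1) \<ge> 0"
    using assms(1) by simp
  ultimately have "(x * y) ^ m * (y - x) - (y ^ m * (y + 1) - x ^ m * (x + 1)) \<ge> 0"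
    by (simp add: power_mult_distrib d_def mult_ac)
  then show ?thesis
    using assms unfolding kernel_def by (intro mult_nonneg_nonneg) auto
qed

text \<open>The pair \<open>(1, y)\<close> contributes at least
  \<open>-2 * y * (y - 1) * y ^ m\<close>, while the pair \<open>(2, y)\<close> has order
  \<open>2 ^ m * y ^ m * y ^ 2\<close> with \<open>2 ^ m \<ge> 16\<close>. The weights
  \<open>a\<close> and \<open>b\<close> are those of the points 1 and 2.\<close>

lemma kernel_one_two_nonneg:
  assumes "y \<ge> 4" "m \<ge> 4" "0 \<le> a" "a \<le> 3 * b"
  shows "a * kernel m 1 1 y + b * kernel m 1 2 y \<ge> 0"
proof -
  define z where "z = y ^ m"
  have b: "b \<ge> 0" and z: "z \<ge> 0"
    using assms by (auto simp: z_def)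
  have pow: "(2::real) ^ m \<ge> 16"
    using power_increasing[OF assms(2), of "2::real"] by simp
  have "y * (y - 1) * (- 2 * z) \<le> kernel m 1 1 y"
  proof -
    have "y * (y - 1) * (- 2 * z) \<le> y * (y - 1) * (2 - 2 * z)"
      using assms by (intro mult_left_mono) auto
    also have "\<dots> = kernel m 1 1 y"
      by (simp add: kernel_def z_def algebra_simps)
    finally show ?thesis .
  qed
  then have "a * (y * (y - 1) * (- 2 * z)) \<le> a * kernel m 1 1 y"
    using assms by (intro mult_left_mono)
  moreover have "3 * b * (y * (y - 1) * (2 * z)) \<ge> a * (y * (y - 1) * (2 * z))"
    using assms z by (intro mult_right_mono) auto
  ultimately have 1: "a * kernel m 1 1 y \<ge> b * (y * z * (- 6 * (y - 1)))"
    by (simp add: algebra_simps)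
  have "z * (16 * (y - 2) - (y + 1)) \<le> z * (2 ^ m * (y - 2) - (y + 1))"
    using z mult_right_mono[OF pow, of "y - 2"] assms(1) by (intro mult_left_mono) auto
  also have "\<dots> \<le> z * (2 ^ m * (y - 2) - (y + 1)) + 2 ^ m * 3"
    by simp
  finally have "2 * (y - 2) * y * (z * (16 * (y - 2) - (y + 1))) \<le>
      2 * (y - 2) * y * (z * (2 ^ m * (y - 2) - (y + 1)) + 2 ^ m * 3)"
    using assms by (intro mult_left_mono) auto
  also have "\<dots> = kernel m 1 2 y"
    by (simp add: kernel_def z_def power_mult_distrib algebra_simps)
  finally have "b * (2 * (y - 2) * y * (z * (16 * (y - 2) - (y + 1)))) \<le> b * kernel m 1 2 y"
    using b by (rule mult_left_mono)
  with 1 have "b * (y * z * (2 * (y - 2) * (15 * y - 33) - 6 * (y - 1)))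
      \<le> a * kernel m 1 1 y + b * kernel m 1 2 y"
    by (simp add: algebra_simps)
  moreover have "2 * (y - 2) * (15 * y - 33) - 6 * (y - 1) \<ge> 0"
  proof -
    \<comment> \<open>27 is the value of \<open>15 * y - 33\<close> at the smallest admissible
      \<open>y = 4\<close>.\<close>
    have "2 * (y - 2) * 27 \<le> 2 * (y - 2) * (15 * y - 33)"
      using assms by (intro mult_left_mono) auto
    moreover have "6 * (y - 1) \<le> 2 * (y - 2) * 27"
      using assms(1) by simp
    ultimately show ?thesis
      by simp
  qed
  ultimately show ?thesis
    using b z assms(1) by (smt (verit) mult_nonneg_nonneg)
qed

text \<open>The weights of the points 1, 2, 3 are \<open>a\<close>, \<open>b\<close>,
  \<open>c\<close>. The pair \<open>(2, 3)\<close> contains \<open>6 ^ m\<close> and pays for both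
  negative pairs once \<open>a\<close> is replaced by \<open>12 * c\<close> in the first and by
  \<open>3 * b\<close> in the second.\<close>

lemma kernel_initial_pos:
  assumes pos: "0 < a" "0 < b" "0 < c" and "a \<le> 3 * b" "a \<le> 12 * c" "m \<ge> 4"
  shows "a * b * kernel m 1 1 2 + a * c * kernel m 1 1 3 + b * c * kernel m 1 2 3 > 0"
proof -
  define M T where "M = (2::real) ^ m" and "T = (3::real) ^ m"
  have M: "M \<ge> 16"
    using power_increasing[OF assms(6), of "2::real"] by (simp add: M_def)
  have T: "T \<ge> M"
    by (simp add: M_def T_def power_mono)
  have "(6::real) ^ m = M * T"
    using power_mult_distrib[of "2::real" 3 m] by (simp add: M_def T_def)
  then have k: "kernel m 1 1 2 = 4 - 4 * M" "kernel m 1 1 3 = 12 - 12 * T"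
    "kernel m 1 2 3 = 6 * (M * T - 4 * T + 3 * M)"
    by (simp_all add: kernel_def M_def T_def algebra_simps)
  have "a * b * (4 * M) \<le> 12 * c * b * (4 * M)" "a * c * (12 * T) \<le> 3 * b * c * (12 * T)"
    using assms M T by (intro mult_right_mono; simp)+
  moreover have "a * b * 4 > 0" "a * c * 12 > 0"
    using pos by auto
  ultimately have "a * b * (4 - 4 * M) + a * c * (12 - 12 * T) + b * c * (6 * (M * T - 4 * T + 3 * M))
      \<ge> b * c * (6 * (M * T - 4 * T + 3 * M) - 48 * M - 36 * T)"
    by (simp add: algebra_simps)
  moreover have "6 * (M * T - 4 * T + 3 * M) - 48 * M - 36 * T > 0"
  proof -
    have "16 * T \<le> M * T"
      using M T by (intro mult_right_mono) auto
    moreover have "6 * (M * T - 4 * T + 3 * M) - 48 * M - 36 * T = 6 * (M * T) - 60 * T - 30 * M"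
      by simp
    ultimately show ?thesis
      using M T by linarith
  qed
  ultimately show ?thesis
    unfolding k using pos by (smt (verit) mult_pos_pos)
qed

section \<open>Partial sums\<close>

text \<open>This is the contribution of all pairs with larger element \<open>N\<close>, up to the
  factor \<open>Bell_weight p N\<close>. For \<open>e = 1\<close> the terms with
  \<open>x \<ge> 3\<close> are nonnegative one by one, and \<open>x = 1\<close> is balanced by
  \<open>x = 2\<close>.\<close>

lemma kernel_weighted_sum_nonneg:
  assumes N: "N \<ge> 4" and m: "m \<ge> 3" and e: "e = -1 \<or> e = 1 \<and> m \<ge> 4"
  shows "(\<Sum>x<N. Bell_weight p x * kernel m e (real x) (real N)) \<ge> 0"
proof (cases "e = -1")
  case True
  then show ?thesis
    by (auto intro!: sum_nonneg mult_nonneg_nonneg kernel_minus_nonneg less_imp_le[OF Bell_weight_pos])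
next
  case False
  with e have e: "e = 1" "m \<ge> 4" by auto
  let ?f = "\<lambda>x. Bell_weight p x * kernel m e (real x) (real N)"
  have "sum ?f {..<N} = sum ?f {..<3} + sum ?f {3..<N}"
    using N by (subst sum.union_disjoint[symmetric]) (auto intro: sum.cong)
  moreover have "sum ?f {3..<N} \<ge> 0"
    using e by (auto intro!: sum_nonneg mult_nonneg_nonneg kernel_plus_nonneg less_imp_le[OF Bell_weight_pos])
  \<comment> \<open>The term at 0 drops out through the factor \<open>x\<close> of the
    kernel.\<close>
  moreover have "sum ?f {..<3} = ?f 1 + ?f 2"
    by (simp add: eval_nat_numeral kernel_def)
  moreover have "?f 1 + ?f 2 \<ge> 0"
  proof -
    have "(2::real) ^ p \<le> 3 ^ p"
      by (simp add: power_mono)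
    then have "Bell_weight p 1 \<le> 3 * Bell_weight p 2"
      by (simp add: Bell_weight_def eval_nat_numeral)
    then show ?thesis
      using kernel_one_two_nonneg[of "real N" m "Bell_weight p 1" "Bell_weight p 2"] e N
      by (simp add: less_imp_le[OF Bell_weight_pos])
  qed
  ultimately show ?thesis
    by linarith
qed

text \<open>The pairs below 4 provide the strictness of the final inequality. For
  \<open>e = -1\<close> the pair \<open>(1, 2)\<close> alone is already positive.\<close>

lemma Bell_weight_pairs_pos:
  assumes m: "m \<ge> 3" and e: "e = -1 \<or> e = 1 \<and> m \<ge> 4"
  shows "Bell_weight p 1 * Bell_weight p 2 * kernel m e 1 2 + Bell_weight p 1 * Bell_weight p 3 * kernel m e 1 3
    + Bell_weight p 2 * Bell_weight p 3 * kernel m e 2 3 > 0"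
proof (cases "e = -1")
  case True
  have "(2::real) ^ m \<ge> 1"
    by simp
  then have "1 < 2 * (2::real) ^ m"
    by linarith
  then have "kernel m e 1 2 > 0"
    unfolding True kernel_def by simp
  moreover have "kernel m e 1 3 \<ge> 0" "kernel m e 2 3 \<ge> 0"
    unfolding True by (auto intro: kernel_minus_nonneg)
  ultimately show ?thesis
    by (intro add_pos_nonneg mult_pos_pos mult_nonneg_nonneg Bell_weight_pos less_imp_le[OF Bell_weight_pos])
next
  case False
  have "(2::real) ^ p \<le> 3 ^ p" "(2::real) ^ p \<le> 4 ^ p"
    by (simp_all add: power_mono)
  then have "Bell_weight p 1 \<le> 3 * Bell_weight p 2" "Bell_weight p 1 \<le> 12 * Bell_weight p 3"
    by (simp_all add: Bell_weight_def eval_nat_numeral)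
  then show ?thesis
    using False e kernel_initial_pos Bell_weight_pos by simp
qed

text \<open>Passing from \<open>N\<close> to \<open>Suc N\<close> adds exactly the pairs
  \<open>(x, N)\<close> with \<open>x < N\<close>; the diagonal term at \<open>N\<close> cancels.
  The symmetrisation thus needs finite sums only.\<close>

lemma Bell_weight_partial_sums:
  fixes p m :: nat and e :: real
  defines "A \<equiv> \<lambda>N. \<Sum>k<N. Bell_weight p k * ((real k + 1) * real k ^ (m + 1))"
    and "T \<equiv> \<lambda>N. \<Sum>k<N. Bell_weight p k * (real k * (real k ^ (m + 2) + e * real k))"
    and "C \<equiv> \<lambda>N. \<Sum>k<N. Bell_weight p k * ((real k + 1) * real k ^ (m + 2))"
    and "S \<equiv> \<lambda>N. \<Sum>k<N. Bell_weight p k * (real k ^ (m + 2) + e * real k)"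
  shows "A (Suc N) * T (Suc N) - C (Suc N) * S (Suc N) =
    A N * T N - C N * S N + Bell_weight p N * (\<Sum>x<N. Bell_weight p x * kernel m e (real x) (real N))"
proof -
  let ?v = "Bell_weight p" and ?y = "real N"
  define a where "a x = (x + 1) * x ^ (m + 1)" for x :: real
  define g where "g x = x ^ (m + 2) + e * x" for x :: real
  have A: "A N = (\<Sum>k<N. ?v k * a (real k))" for N
    by (simp add: A_def a_def)
  have T: "T N = (\<Sum>k<N. ?v k * (real k * g (real k)))" for N
    by (simp add: T_def g_def)
  have C: "C N = (\<Sum>k<N. ?v k * (real k * a (real k)))" for N
    by (simp add: C_def a_def mult_ac)
  have S: "S N = (\<Sum>k<N. ?v k * g (real k))" for N
    by (simp add: S_def g_def)
  have kernel: "kernel m e x y = (y - x) * (a x * g y - a y * g x)" for x y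
    unfolding a_def g_def by (rule kernel_eq[symmetric])
  have "?v N * (\<Sum>x<N. ?v x * kernel m e (real x) ?y) =
      (\<Sum>x<N. ?v x * a (real x) * (?v N * (?y * g ?y)) + ?v N * a ?y * (?v x * (real x * g (real x)))
        - ?v x * (real x * a (real x)) * (?v N * g ?y) - ?v N * (?y * a ?y) * (?v x * g (real x)))"
    unfolding sum_distrib_left kernel by (intro sum.cong refl) (simp add: algebra_simps)
  also have "\<dots> = A N * (?v N * (?y * g ?y)) + ?v N * a ?y * T N
      - C N * (?v N * g ?y) - ?v N * (?y * a ?y) * S N"
    unfolding A T C S by (simp only: sum.distrib sum_subtractf sum_distrib_left sum_distrib_right)
  finally have "?v N * (\<Sum>x<N. ?v x * kernel m e (real x) ?y) = \<dots>" .
  moreover have "A (Suc N) = A N + ?v N * a ?y" "T (Suc N) = T N + ?v N * (?y * g ?y)"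
    "C (Suc N) = C N + ?v N * (?y * a ?y)" "S (Suc N) = S N + ?v N * g ?y"
    by (simp_all add: A T C S)
  ultimately show ?thesis
    by (simp add: algebra_simps)
qed

section \<open>Passage to the limit in the partial sums\<close>

theorem corollary19:
  fixes n p :: nat
  assumes "n \<ge> 5"
  shows "(\<Sum>i=0..p. int (p choose i) * int (Bell (n + i - 1))) *
         (\<Sum>j=1..n-1. (-1) ^ (j + 1) * (\<Sum>i=0..p. int (p choose i) * int (Bell (n + i - j + 1))))
       > (\<Sum>i=0..p. int (p choose i) * int (Bell (n + i))) *
         (\<Sum>j=1..n-1. (-1) ^ (j + 1) * (\<Sum>i=0..p. int (p choose i) * int (Bell (n + i - j))))"
    (is "?A * ?T > ?C * ?S")
proof -
  define m e where "m = n - 2" and "e = (-1::real) ^ n"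
  have n: "n = m + 2" and m: "m \<ge> 3"
    using assms by (auto simp: m_def)
  \<comment> \<open>An even \<open>n \<ge> 5\<close> is at least 6, which gives the stronger bound
    on \<open>m\<close> exactly when \<open>e = 1\<close>.\<close>
  have e: "e = -1 \<or> e = 1 \<and> m \<ge> 4"
  proof (cases "even n")
    case True
    then have "m \<noteq> 3"
      using n by auto
    then show ?thesis
      using True m by (auto simp: e_def)
  qed (simp add: e_def)
  let ?v = "Bell_weight p"
  define A T C S where
    "A = (\<lambda>N. \<Sum>k<N. ?v k * ((real k + 1) * real k ^ (m + 1)))"
    and "T = (\<lambda>N. \<Sum>k<N. ?v k * (real k * (real k ^ (m + 2) + e * real k)))"
    and "C = (\<lambda>N. \<Sum>k<N. ?v k * ((real k + 1) * real k ^ (m + 2)))"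
    and "S = (\<lambda>N. \<Sum>k<N. ?v k * (real k ^ (m + 2) + e * real k))"
  define W where "W N = A N * T N - C N * S N" for N
  have W_Suc: "W (Suc N) = W N + ?v N * (\<Sum>x<N. ?v x * kernel m e (real x) (real N))" for N
    unfolding W_def A_def T_def C_def S_def by (rule Bell_weight_partial_sums)
  have W0: "W 0 = 0"
    by (simp add: W_def A_def C_def)
  have "W 4 = ?v 1 * ?v 2 * kernel m e 1 2 + ?v 1 * ?v 3 * kernel m e 1 3 + ?v 2 * ?v 3 * kernel m e 2 3"
  proof -
    have zero: "kernel m e 0 y = 0" for y
      by (simp add: kernel_def)
    have "W 4 = W (Suc (Suc (Suc (Suc 0))))"
      by (simp add: eval_nat_numeral)
    also have "\<dots> = ?v 1 * ?v 2 * kernel m e 1 2 + ?v 1 * ?v 3 * kernel m e 1 3 + ?v 2 * ?v 3 * kernel m e 2 3"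
      unfolding W_Suc W0 by (simp add: zero eval_nat_numeral algebra_simps)
    finally show ?thesis .
  qed
  then have W4: "W 4 > 0"
    using Bell_weight_pairs_pos[OF m e] by simp
  \<comment> \<open>Monotonicity is claimed only from 4 on: for even \<open>n\<close> the value
    \<open>W 3\<close> is negative, as it consists of the pair \<open>(1, 2)\<close>.\<close>
  have W_ge: "W N \<ge> W 4" if "N \<ge> 4" for N
    using that
  proof (induction N rule: dec_induct)
    case (step N)
    have "?v N * (\<Sum>x<N. ?v x * kernel m e (real x) (real N)) \<ge> 0"
      using step.hyps by (intro mult_nonneg_nonneg kernel_weighted_sum_nonneg m e less_imp_le[OF Bell_weight_pos])
    with step.IH show ?case
      unfolding W_Suc by linarith
  qed simp
  have nm: "n + i - Suc 0 = Suc (m + i)" for i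
    by (simp add: n)
  have "A \<longlonglongrightarrow> exp 1 * of_int ?A"
    using binomial_Bell_sums[of p "m + 1"] by (simp add: A_def sums_def nm)
  moreover have "T \<longlonglongrightarrow> exp 1 * of_int ?T"
    using alternating_Bell_sums[of n p 1] assms by (simp add: T_def sums_def e_def n)
  moreover have "C \<longlonglongrightarrow> exp 1 * of_int ?C"
    using binomial_Bell_sums[of p n] by (simp add: C_def sums_def n)
  moreover have "S \<longlonglongrightarrow> exp 1 * of_int ?S"
    using alternating_Bell_sums[of n p 0] assms by (simp add: S_def sums_def e_def n)
  ultimately have "W \<longlonglongrightarrow> exp 1 * of_int ?A * (exp 1 * of_int ?T) - exp 1 * of_int ?C * (exp 1 * of_int ?S)"
    unfolding W_def by (intro tendsto_intros)
  \<comment> \<open>The fixed positive lower bound \<open>W 4\<close> keeps the inequality strict in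
    the limit.\<close>
  then have "W 4 \<le> exp 1 * of_int ?A * (exp 1 * of_int ?T) - exp 1 * of_int ?C * (exp 1 * of_int ?S)"
    by (rule LIMSEQ_le_const) (use W_ge in blast)
  also have "\<dots> = (exp 1)\<^sup>2 * of_int (?A * ?T - ?C * ?S)"
    by (simp only: of_int_diff of_int_mult power2_eq_square) (simp only: algebra_simps)
  finally have "(exp 1)\<^sup>2 * real_of_int (?A * ?T - ?C * ?S) > 0"
    using W4 by linarith
  then have "?A * ?T - ?C * ?S > 0"
    by (simp only: zero_less_mult_iff of_int_0_less_iff) (simp add: not_less)
  then show ?thesis
    by linarith
qed

end
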